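(* Let $\Gamma$ be an LDDG with parameters $(v,k,\lambda_1,\lambda_2,m,n)$ and let $\theta$ be an automorphism of order $2$ of $\Gamma$. Define a graph $\Gamma_\theta$ on the same vertex set as $\Gamma$ by declaring two (possibly equal) vertices $x$ and $y$ adjacent in $\Gamma_\theta$ if and only if $x^\theta$ and $y$ are adjacent in $\Gamma$. Then: (1) $\Gamma_\theta$ is an LDDG with the same parameters as $\Gamma$; (2) if $N$ denotes the number of loops of $\Gamma$, $A_1$ the number of vertices $x$ without a loop in $\Gamma$ for which $x^\theta$ is adjacent to $x$ in $\Gamma$, and $A_2$ the number of vertices $y$ with a loop in $\Gamma$ for which $y^\theta$ is not adjacent to $y$ in $\Gamma$, then the number of loops in $\Gamma_\theta$ equals $N + A_1 - A_2$.
   Context: Graphs here are finite, undirected, without multiple edges, but loops are allowed: a vertex may be adjacent to itself (it then has a loop). For a vertex $x$, $\Gamma(x)$ is the set of vertices adjacent to $x$ (containing $x$ iff $x$ has a loop), and the degree of $x$ is $|\Gamma(x)|$. Common neighbours of $x,y$ are the elements of $\Gamma(x)\cap\Gamma(y)$. A $k$-regular graph on $v$ vertices is an LDDG with parameters $(v,k,\lambda_1,\lambda_2,m,n)$ if its vertex set can be partitioned into $m$ classes of size $n$ such that any two distinct vertices of the same class have exactly $\lambda_1$ common neighbours and any two vertices of different classes have exactly $\lambda_2$ common neighbours. An automorphism is a permutation of the vertices preserving adjacency (including loops); order 2 means $\theta^2=\mathrm{id}\neq\theta$. *)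

theory Defs
  imports "HOL-Combinatorics.Permutations" "HOL-Library.Disjoint_Sets"
begin

text \<open>A finite undirected graph without multiple edges, possibly with loops, is a finite vertex
  set \<open>V\<close> with a symmetric adjacency relation \<open>E\<close> on \<open>V\<close>; a loop at \<open>x\<close> is a pair \<open>(x, x)\<close> in \<open>E\<close>.\<close>

definition loop_graph :: "'a set \<Rightarrow> 'a rel \<Rightarrow> bool" where
  "loop_graph V E \<longleftrightarrow> finite V \<and> E \<subseteq> V \<times> V \<and> sym E"

definition neighbours :: "'a rel \<Rightarrow> 'a \<Rightarrow> 'a set" where
  "neighbours E x = E `` {x}"

definition common_neighbours :: "'a rel \<Rightarrow> 'a \<Rightarrow> 'a \<Rightarrow> 'a set" where
  "common_neighbours E x y = neighbours E x \<inter> neighbours E y"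

definition regular_graph :: "'a set \<Rightarrow> 'a rel \<Rightarrow> nat \<Rightarrow> bool" where
  "regular_graph V E k \<longleftrightarrow> loop_graph V E \<and> (\<forall>x\<in>V. card (neighbours E x) = k)"

definition LDDG ::
  "'a set \<Rightarrow> 'a rel \<Rightarrow> nat \<Rightarrow> nat \<Rightarrow> nat \<Rightarrow> nat \<Rightarrow> nat \<Rightarrow> nat \<Rightarrow> bool" where
  "LDDG V E v k lambda1 lambda2 m n \<longleftrightarrow>
     regular_graph V E k \<and> card V = v \<and>
     (\<exists>P. partition_on V P \<and> card P = m \<and> (\<forall>C\<in>P. card C = n) \<and>
        (\<forall>C\<in>P. \<forall>x\<in>C. \<forall>y\<in>C. x \<noteq> y \<longrightarrow> card (common_neighbours E x y) = lambda1) \<and>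
        (\<forall>C\<in>P. \<forall>D\<in>P. C \<noteq> D \<longrightarrow>
           (\<forall>x\<in>C. \<forall>y\<in>D. card (common_neighbours E x y) = lambda2)))"

text \<open>An automorphism is a map on the whole type that is the identity outside \<open>V\<close>
  (this is part of \<open>permutes\<close>), so that maps agreeing on \<open>V\<close> are equal and the order
  condition can be stated with \<open>id\<close>.\<close>

definition graph_automorphism :: "'a set \<Rightarrow> 'a rel \<Rightarrow> ('a \<Rightarrow> 'a) \<Rightarrow> bool" where
  "graph_automorphism V E \<theta> \<longleftrightarrow>
     \<theta> permutes V \<and> (\<forall>x\<in>V. \<forall>y\<in>V. (\<theta> x, \<theta> y) \<in> E \<longleftrightarrow> (x, y) \<in> E)"

definition order_two :: "('a \<Rightarrow> 'a) \<Rightarrow> bool" where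
  "order_two \<theta> \<longleftrightarrow> \<theta> \<circ> \<theta> = id \<and> \<theta> \<noteq> id"

definition twisted_adj :: "'a set \<Rightarrow> 'a rel \<Rightarrow> ('a \<Rightarrow> 'a) \<Rightarrow> 'a rel" where
  "twisted_adj V E \<theta> = {(x, y). x \<in> V \<and> y \<in> V \<and> (\<theta> x, y) \<in> E}"

definition num_loops :: "'a set \<Rightarrow> 'a rel \<Rightarrow> nat" where
  "num_loops V E = card {x \<in> V. (x, x) \<in> E}"

end

theory Submission
  imports Defs
begin

text \<open>The neighbourhood of \<open>x\<close> in the twisted graph is the \<open>\<theta>\<close>-image of its neighbourhood in the
  original graph, so all sizes of (common) neighbourhoods are unchanged, and the same partition
  works. The twisted relation is symmetric because \<open>\<theta>\<close> is an involution.\<close>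

text \<open>As \<open>E\<close> lies inside \<open>V \<times> V\<close> and \<open>\<theta>\<close>
  maps \<open>V\<close> onto itself, every neighbour of \<open>\<theta> x\<close> is
  \<open>\<theta> z\<close> for some \<open>z\<close> in \<open>V\<close>. Reflecting adjacency
  makes \<open>z\<close> a neighbour of \<open>x\<close>; preserving it gives the converse
  inclusion.\<close>

lemma neighbours_automorphism:
  assumes "graph_automorphism V E \<theta>" "E \<subseteq> V \<times> V" "x \<in> V"
  shows "neighbours E (\<theta> x) = \<theta> ` neighbours E x"
proof -
  have perm: "\<theta> permutes V"
    and adj: "\<And>x y. x \<in> V \<Longrightarrow> y \<in> V \<Longrightarrow> (\<theta> x, \<theta> y) \<in> E \<longleftrightarrow> (x, y) \<in> E"
    using assms(1) by (auto simp: graph_automorphism_def)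
  show ?thesis
  proof (intro equalityI subsetI)
    fix y assume y: "y \<in> neighbours E (\<theta> x)"
    then have "y \<in> V" using assms(2) by (auto simp: neighbours_def)
    then obtain z where "z \<in> V" "y = \<theta> z"
      using permutes_image[OF perm] by blast
    then show "y \<in> \<theta> ` neighbours E x"
      using y adj assms(3) by (auto simp: neighbours_def)
  next
    fix y assume "y \<in> \<theta> ` neighbours E x"
    then show "y \<in> neighbours E (\<theta> x)"
      using adj assms(2,3) by (auto simp: neighbours_def)
  qed
qed

lemma neighbours_twisted_adj:
  assumes "graph_automorphism V E \<theta>" "E \<subseteq> V \<times> V" "x \<in> V"
  shows "neighbours (twisted_adj V E \<theta>) x = \<theta> ` neighbours E x"
proof -
  have "neighbours (twisted_adj V E \<theta>) x = neighbours E (\<theta> x)"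
    using assms(2,3) by (auto simp: neighbours_def twisted_adj_def)
  then show ?thesis using neighbours_automorphism[OF assms] by simp
qed

lemma card_neighbours_twisted_adj:
  assumes "graph_automorphism V E \<theta>" "E \<subseteq> V \<times> V" "x \<in> V"
  shows "card (neighbours (twisted_adj V E \<theta>) x) = card (neighbours E x)"
proof -
  have "inj \<theta>" using assms(1) by (auto simp: graph_automorphism_def permutes_inj)
  then show ?thesis
    by (simp add: neighbours_twisted_adj[OF assms] card_image inj_on_subset)
qed

text \<open>Taking images under an injective map commutes with intersection, so the two image
  neighbourhoods meet exactly in the image of the old common neighbourhood, which has the same
  size.\<close>

lemma card_common_neighbours_twisted_adj:
  assumes "graph_automorphism V E \<theta>" "E \<subseteq> V \<times> V" "x \<in> V" "y \<in> V"
  shows "card (common_neighbours (twisted_adj V E \<theta>) x y) = card (common_neighbours E x y)"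
proof -
  have "inj \<theta>" using assms(1) by (auto simp: graph_automorphism_def permutes_inj)
  moreover have "common_neighbours (twisted_adj V E \<theta>) x y = \<theta> ` common_neighbours E x y"
    by (simp add: common_neighbours_def neighbours_twisted_adj[OF assms(1,2)] assms(3,4)
        image_Int[OF \<open>inj \<theta>\<close>])
  ultimately show ?thesis by (simp add: card_image inj_on_subset)
qed

lemma loop_graph_twisted_adj:
  assumes "loop_graph V E" "graph_automorphism V E \<theta>" "\<theta> \<circ> \<theta> = id"
  shows "loop_graph V (twisted_adj V E \<theta>)"
proof -
  have "(\<theta> y, x) \<in> E" if "x \<in> V" "y \<in> V" "(\<theta> x, y) \<in> E" for x y
  proof -
    have "\<theta> x \<in> V"
      using assms(2) that(1) by (simp add: graph_automorphism_def permutes_in_image)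
    moreover have "\<theta> (\<theta> x) = x"
      using assms(3) by (rule pointfree_idE)
    \<comment> \<open>Applying \<open>\<theta>\<close> to both ends of the edge
      \<open>(\<theta> x, y)\<close> gives \<open>(\<theta> (\<theta> x), \<theta> y)\<close>, whose
      first end is \<open>x\<close>. Symmetry of \<open>E\<close> then turns this edge
      around.\<close>
    ultimately have "(x, \<theta> y) \<in> E"
      using assms(2) that unfolding graph_automorphism_def by metis
    then show ?thesis using assms(1) by (auto simp: loop_graph_def dest: symD)
  qed
  then show ?thesis
    using assms(1) by (auto simp: loop_graph_def twisted_adj_def sym_def)
qed

lemma LDDG_twisted_adj:
  assumes "LDDG V E v k lambda1 lambda2 m n" "graph_automorphism V E \<theta>" "\<theta> \<circ> \<theta> = id"
  shows "LDDG V (twisted_adj V E \<theta>) v k lambda1 lambda2 m n"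
proof -
  have graph: "loop_graph V E" and sub: "E \<subseteq> V \<times> V"
    using assms(1) by (auto simp: LDDG_def regular_graph_def loop_graph_def)
  obtain P where P: "partition_on V P" "card P = m" "\<forall>C\<in>P. card C = n"
    "\<forall>C\<in>P. \<forall>x\<in>C. \<forall>y\<in>C. x \<noteq> y \<longrightarrow> card (common_neighbours E x y) = lambda1"
    "\<forall>C\<in>P. \<forall>D\<in>P. C \<noteq> D \<longrightarrow> (\<forall>x\<in>C. \<forall>y\<in>D. card (common_neighbours E x y) = lambda2)"
    using assms(1) unfolding LDDG_def by (elim conjE exE)
  have inV: "x \<in> V" if "C \<in> P" "x \<in> C" for x C
    using partition_onD1[OF P(1)] that by blast
  \<comment> \<open>Classes of \<open>P\<close> are subsets of \<open>V\<close>, so this one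
    equation covers pairs within a class as well as pairs from different classes.\<close>
  note common = card_common_neighbours_twisted_adj[OF assms(2) sub inV inV]
  have "regular_graph V (twisted_adj V E \<theta>) k"
    using assms(1) loop_graph_twisted_adj[OF graph assms(2,3)]
    by (simp add: LDDG_def regular_graph_def card_neighbours_twisted_adj[OF assms(2) sub])
  moreover have "card V = v"
    using assms(1) by (simp add: LDDG_def)
  moreover have "\<forall>C\<in>P. \<forall>x\<in>C. \<forall>y\<in>C. x \<noteq> y \<longrightarrow>
      card (common_neighbours (twisted_adj V E \<theta>) x y) = lambda1"
    using P(4) by (simp add: common)
  moreover have "\<forall>C\<in>P. \<forall>D\<in>P. C \<noteq> D \<longrightarrow>
      (\<forall>x\<in>C. \<forall>y\<in>D. card (common_neighbours (twisted_adj V E \<theta>) x y) = lambda2)"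
    using P(5) by (simp add: common)
  ultimately show ?thesis
    using P(1-3) unfolding LDDG_def by (intro conjI exI[of _ P])
qed

text \<open>Both sides count the vertices \<open>x\<close> that have a loop or are adjacent to
  \<open>\<theta> x\<close>, split in two ways. The additive form avoids truncated subtraction on
  \<open>nat\<close>; the difference is taken later in \<open>int\<close>.\<close>

lemma num_loops_twisted_adj:
  assumes "finite V"
  shows "num_loops V (twisted_adj V E \<theta>) + card {y \<in> V. (y, y) \<in> E \<and> (\<theta> y, y) \<notin> E} =
    num_loops V E + card {x \<in> V. (x, x) \<notin> E \<and> (\<theta> x, x) \<in> E}"
proof -
  let ?L = "{x \<in> V. (x, x) \<in> E}" and ?T = "{x \<in> V. (\<theta> x, x) \<in> E}"
  let ?A1 = "{x \<in> V. (x, x) \<notin> E \<and> (\<theta> x, x) \<in> E}"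
    and ?A2 = "{y \<in> V. (y, y) \<in> E \<and> (\<theta> y, y) \<notin> E}"
  have "card ?T + card ?A2 = card (?T \<union> ?A2)"
    using assms by (subst card_Un_disjoint) auto
  also have "?T \<union> ?A2 = ?L \<union> ?A1" by blast
  also have "card (?L \<union> ?A1) = card ?L + card ?A1"
    using assms by (subst card_Un_disjoint) auto
  \<comment> \<open>\<open>?T\<close> is the set of loops of the twisted graph:
    \<open>(x, x)\<close> is a twisted edge iff \<open>x\<close> is in \<open>V\<close> and
    \<open>(\<theta> x, x)\<close> is in \<open>E\<close>.\<close>
  finally show ?thesis by (simp add: num_loops_def twisted_adj_def cong: conj_cong)
qed

theorem theorem3p28:
  fixes V :: "'a set" and E :: "'a rel" and \<theta> :: "'a \<Rightarrow> 'a"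
    and v k lambda1 lambda2 m n N A1 A2 :: nat
  assumes "LDDG V E v k lambda1 lambda2 m n"
    and "graph_automorphism V E \<theta>"
    and "order_two \<theta>"
    and "N = num_loops V E"
    and "A1 = card {x \<in> V. (x, x) \<notin> E \<and> (\<theta> x, x) \<in> E}"
    and "A2 = card {y \<in> V. (y, y) \<in> E \<and> (\<theta> y, y) \<notin> E}"
  shows "LDDG V (twisted_adj V E \<theta>) v k lambda1 lambda2 m n \<and>
    int (num_loops V (twisted_adj V E \<theta>)) = int N + int A1 - int A2"
proof
  show "LDDG V (twisted_adj V E \<theta>) v k lambda1 lambda2 m n"
    using LDDG_twisted_adj assms(1-3) by (auto simp: order_two_def)
  have "finite V"
    using assms(1) by (simp add: LDDG_def regular_graph_def loop_graph_def)
  from num_loops_twisted_adj[OF this, of E \<theta>]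
  show "int (num_loops V (twisted_adj V E \<theta>)) = int N + int A1 - int A2"
    unfolding assms(4-6) by linarith
qed

end
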